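(* Let $\bar\Sigma=\beta\bar x\bar x^T+tI_n$ with $\beta\ge0$, $t\in\mathbb{R}$, where $\bar x\in\mathbb{R}^n$ satisfies $\|\bar x\|_0=k\ge2$ and $\|\bar x\|=1$. Suppose that $\Sigma\in\mathbb{S}^n$ lies in a small neighborhood of $\bar\Sigma$. Let $c=\min\{|\bar x_i|: i\in\operatorname{supp}(\bar x)\}$. If the objective matrix $\Sigma$ satisfies $$\|\pi_{L^\perp}(\Sigma-\bar\Sigma)\|<\nu\beta,$$ where $$\nu<\min\Big\{\tfrac12\Big(\tfrac32+\tfrac{3+4\sqrt2}{c}\Big)^{-1},\ \tfrac{c^2}{4}\Big\},$$ then the semidefinite program $$\max_{X\in\mathbb{S}^n}\Sigma\bullet X\quad\text{s.t. }\operatorname{Tr}(X)=1,\ X\in\mathcal{S}_{n,k}$$ is exact.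
   Context: $\mathbb{S}^n$ is the space of real symmetric $n\times n$ matrices, $A\bullet B=\operatorname{Tr}(B^TA)$, $A\succeq B$ means $A-B$ is positive semidefinite, $\operatorname{diag}(X)$ is the diagonal matrix with the same diagonal as $X$, $\|x\|_0$ is the number of nonzero entries of $x$, $\operatorname{supp}(x)$ is the set of indices of the nonzero entries of $x$, $\|x\|$ is the Euclidean norm of a vector, and $\|M\|$ is the spectral norm of a matrix. $\mathcal{S}_{n,k}=\{X\in\mathbb{S}^n: k\operatorname{diag}(X)\succeq X\succeq 0\}$. $L=\{sI_n:s\in\mathbb{R}\}$ and $\pi_{L^\perp}$ is the projection of $\mathbb{S}^n$ onto the orthogonal complement $L^\perp$ of $L$ (trace inner product). The SDP is a relaxation of the sparse PCA problem $\max x^T\Sigma x$ s.t. $\|x\|_0\le k$, $\|x\|_2^2=1$; it is called exact when any optimal solution of the SDP is a rank-one matrix $X=xx^T$, in which case $\|x\|_0\le k$ and $x$ is optimal for the sparse PCA problem. *)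

theory Defs
  imports "HOL-Analysis.Analysis"
begin

section \<open>Matrices\<close>

definition sym_mats :: "(real^'n^'n) set" where
  "sym_mats = {A. transpose A = A}"

definition mat_inner :: "real^'n^'n \<Rightarrow> real^'n^'n \<Rightarrow> real" where
  "mat_inner A B = trace (transpose B ** A)"

definition psd :: "real^'n^'n \<Rightarrow> bool" where
  "psd A \<longleftrightarrow> A \<in> sym_mats \<and> (\<forall>v. 0 \<le> v \<bullet> (A *v v))"

definition loewner_ge :: "real^'n^'n \<Rightarrow> real^'n^'n \<Rightarrow> bool" where
  "loewner_ge A B \<longleftrightarrow> psd (A - B)"

definition diag_part :: "real^'n^'n \<Rightarrow> real^'n^'n" where
  "diag_part A = (\<chi> i j. if i = j then A $ i $ j else 0)"

definition outer :: "real^'n \<Rightarrow> real^'n^'n" where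
  "outer x = (\<chi> i j. x $ i * x $ j)"

text \<open>The \<^const>\<open>norm\<close> of a matrix, as an element of \<^typ>\<open>real^'n^'n\<close>, is the Frobenius norm;
  the spectral norm is the operator norm of the associated linear map.\<close>

definition spectral_norm :: "real^'n^'n \<Rightarrow> real" where
  "spectral_norm A = onorm (\<lambda>v. A *v v)"

definition supp :: "real^'n \<Rightarrow> 'n set" where
  "supp x = {i. x $ i \<noteq> 0}"

definition l0norm :: "real^'n \<Rightarrow> nat" where
  "l0norm x = card (supp x)"


section \<open>Projection onto the orthogonal complement of the multiples of the identity\<close>

definition id_line :: "(real^'n^'n) set" where
  "id_line = {s *\<^sub>R mat 1 | s. True}"

definition id_line_perp :: "(real^'n^'n) set" where
  "id_line_perp = {A \<in> sym_mats. \<forall>B \<in> id_line. mat_inner A B = 0}"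

text \<open>The metric on \<^typ>\<open>real^'n^'n\<close> is the one induced by the trace inner product (see
  \<open>mat_inner_eq_inner\<close>), so the closest point in this subspace is the orthogonal projection.\<close>

definition proj_perp :: "real^'n^'n \<Rightarrow> real^'n^'n" where
  "proj_perp A = closest_point id_line_perp A"


section \<open>The semidefinite program and its exactness\<close>

definition S_set :: "nat \<Rightarrow> (real^'n^'n) set" where
  "S_set k = {X \<in> sym_mats. loewner_ge (real k *\<^sub>R diag_part X) X \<and> loewner_ge X 0}"

definition sdp_feasible :: "nat \<Rightarrow> (real^'n^'n) set" where
  "sdp_feasible k = {X \<in> sym_mats. trace X = 1 \<and> X \<in> S_set k}"

definition sdp_optimal :: "real^'n^'n \<Rightarrow> nat \<Rightarrow> real^'n^'n \<Rightarrow> bool" where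
  "sdp_optimal \<Sigma> k X \<longleftrightarrow> is_arg_max (\<lambda>Y. mat_inner \<Sigma> Y) (\<lambda>Y. Y \<in> sdp_feasible k) X"

text \<open>Exactness quantifies over all optimal solutions. It is not vacuous: one exists by
  \<open>sdp_optimal_exists\<close>. That the vector \<open>x\<close> then is an optimal solution of the sparse PCA problem is
  a consequence, \<open>sdp_exact_spca_optimal\<close>.\<close>

definition sdp_exact :: "real^'n^'n \<Rightarrow> nat \<Rightarrow> bool" where
  "sdp_exact \<Sigma> k \<longleftrightarrow> (\<forall>X. sdp_optimal \<Sigma> k X \<longrightarrow> rank X = 1 \<and> (\<exists>x. X = outer x))"

definition spca_optimal :: "real^'n^'n \<Rightarrow> nat \<Rightarrow> real^'n \<Rightarrow> bool" where
  "spca_optimal \<Sigma> k x \<longleftrightarrow>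
     is_arg_max (\<lambda>y. y \<bullet> (\<Sigma> *v y)) (\<lambda>y. l0norm y \<le> k \<and> (norm y)\<^sup>2 = 1) x"


section \<open>Basic facts about these notions\<close>

lemma mat_inner_eq_inner: "mat_inner A B = A \<bullet> B"
proof -
  have "mat_inner A B = (\<Sum>i\<in>UNIV. \<Sum>j\<in>UNIV. A $ j $ i * B $ j $ i)"
    by (simp add: mat_inner_def trace_def matrix_matrix_mult_def transpose_def mult.commute)
  also have "\<dots> = (\<Sum>j\<in>UNIV. \<Sum>i\<in>UNIV. A $ j $ i * B $ j $ i)"
    by (rule sum.swap)
  finally show ?thesis by (simp add: inner_vec_def)
qed

lemma id_line_perp_eq: "(id_line_perp :: (real^'n^'n) set) = {A \<in> sym_mats. trace A = 0}"
proof -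
  have inner: "mat_inner A (s *\<^sub>R mat 1) = s * trace A" for A :: "real^'n^'n" and s
    by (simp add: mat_inner_eq_inner inner_vec_def mat_def trace_def if_distrib
        sum.delta sum_distrib_left mult.commute cong: if_cong)
  have "(\<forall>B \<in> id_line. mat_inner A B = 0) \<longleftrightarrow> trace A = 0" for A :: "real^'n^'n"
  proof
    assume "\<forall>B \<in> id_line. mat_inner A B = 0"
    moreover have "1 *\<^sub>R mat 1 \<in> (id_line :: (real^'n^'n) set)"
      unfolding id_line_def by blast
    ultimately have "mat_inner A (1 *\<^sub>R mat 1) = 0" by blast
    then show "trace A = 0" unfolding inner by simp
  next
    assume "trace A = 0"
    then show "\<forall>B \<in> id_line. mat_inner A B = 0"
      unfolding id_line_def using inner[of A] by auto
  qed
  then show ?thesis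
    unfolding id_line_perp_def by simp
qed

lemma proj_perp_eq:
  fixes A :: "real^'n^'n"
  assumes "A \<in> sym_mats"
  shows "proj_perp A = A - (trace A / real CARD('n)) *\<^sub>R mat 1"
proof -
  let ?P = "A - (trace A / real CARD('n)) *\<^sub>R mat 1"
  have subs: "subspace (id_line_perp :: (real^'n^'n) set)"
    unfolding id_line_perp_eq subspace_def sym_mats_def
    by (auto simp: trace_def transpose_def vec_eq_iff sum.distrib simp flip: sum_distrib_left)
  have P: "?P \<in> id_line_perp"
    using assms unfolding id_line_perp_eq sym_mats_def
    by (auto simp: trace_def transpose_def vec_eq_iff mat_def sum_subtractf)
  have "dist A ?P \<le> dist A B" if "B \<in> id_line_perp" for B
  proof -
    have "?P - B \<in> id_line_perp"
      using subs P that by (rule subspace_diff)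
    then have "mat_inner (?P - B) ((trace A / real CARD('n)) *\<^sub>R mat 1) = 0"
      unfolding id_line_perp_def id_line_def by blast
    then have "orthogonal (A - ?P) (?P - B)"
      by (simp add: mat_inner_eq_inner orthogonal_def inner_commute)
    then have "(norm (A - ?P + (?P - B)))\<^sup>2 = (norm (A - ?P))\<^sup>2 + (norm (?P - B))\<^sup>2"
      by (rule norm_add_Pythagorean)
    then have "(norm (A - ?P))\<^sup>2 \<le> (norm (A - B))\<^sup>2"
      by simp
    then show ?thesis
      by (metis dist_norm norm_ge_zero power2_le_imp_le)
  qed
  with P have "?P = closest_point id_line_perp A"
    by (intro closest_point_unique subspace_imp_convex closed_subspace subs) auto
  then show ?thesis by (simp add: proj_perp_def)
qed

lemma outer_inner: "v \<bullet> (outer x *v v) = (x \<bullet> v)\<^sup>2"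
proof -
  have "outer x *v v = (x \<bullet> v) *\<^sub>R x"
    by (simp add: vec_eq_iff matrix_vector_mult_def outer_def inner_vec_def sum_distrib_left
        sum_distrib_right ac_simps)
  then show ?thesis by (simp add: power2_eq_square inner_commute)
qed

lemma trace_outer: "trace (outer x) = (norm x)\<^sup>2"
  by (simp add: trace_def outer_def power2_norm_eq_inner inner_vec_def)

lemma mat_inner_outer: "mat_inner A (outer x) = x \<bullet> (A *v x)"
  by (simp add: mat_inner_eq_inner inner_vec_def outer_def matrix_vector_mult_def
      sum_distrib_left ac_simps)

lemma diag_part_inner: "v \<bullet> (diag_part X *v v) = (\<Sum>i\<in>UNIV. X $ i $ i * (v $ i)\<^sup>2)"
  by (simp add: inner_vec_def diag_part_def matrix_vector_mult_def if_distrib if_distribR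
      power2_eq_square ac_simps cong: if_cong)

lemma sym_mats_outer: "outer x \<in> sym_mats"
  by (simp add: sym_mats_def transpose_def outer_def vec_eq_iff mult.commute)

lemma sym_mats_diff: "A \<in> sym_mats \<Longrightarrow> B \<in> sym_mats \<Longrightarrow> A - B \<in> sym_mats"
  by (simp add: sym_mats_def transpose_def vec_eq_iff)

lemma sym_mats_scaled_diag_part: "r *\<^sub>R diag_part A \<in> sym_mats"
  by (simp add: sym_mats_def transpose_def diag_part_def vec_eq_iff)

lemma sdp_feasible_iff:
  "X \<in> sdp_feasible k \<longleftrightarrow> X \<in> sym_mats \<and> trace X = 1 \<and>
     (\<forall>v. 0 \<le> v \<bullet> (X *v v)) \<and> (\<forall>v. v \<bullet> (X *v v) \<le> real k * (\<Sum>i\<in>UNIV. X $ i $ i * (v $ i)\<^sup>2))"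
proof -
  have "v \<bullet> ((real k *\<^sub>R diag_part X - X) *v v)
      = real k * (\<Sum>i\<in>UNIV. X $ i $ i * (v $ i)\<^sup>2) - v \<bullet> (X *v v)" for v
    by (simp add: matrix_vector_mult_diff_rdistrib inner_diff_right
        scaleR_matrix_vector_assoc[symmetric] diag_part_inner)
  then show ?thesis
    by (auto simp: sdp_feasible_def S_set_def loewner_ge_def psd_def
        intro: sym_mats_diff sym_mats_scaled_diag_part)
qed

lemma outer_feasible_iff:
  "outer x \<in> sdp_feasible k \<longleftrightarrow> l0norm x \<le> k \<and> (norm x)\<^sup>2 = 1"
proof -
  have diag: "(\<Sum>i\<in>UNIV. outer x $ i $ i * (v $ i)\<^sup>2) = (\<Sum>i\<in>supp x. (x $ i * v $ i)\<^sup>2)" for v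
    by (rule sum.mono_neutral_cong_right)
       (auto simp: supp_def outer_def power2_eq_square)
  have inn: "x \<bullet> v = (\<Sum>i\<in>supp x. x $ i * v $ i)" for v
    unfolding inner_vec_def
    by (rule sum.mono_neutral_cong_right) (auto simp: supp_def)
  have "l0norm x \<le> k"
    if n: "(norm x)\<^sup>2 = 1"
      and le: "\<forall>v. (x \<bullet> v)\<^sup>2 \<le> real k * (\<Sum>i\<in>supp x. (x $ i * v $ i)\<^sup>2)"
  proof -
    let ?v = "(\<chi> i. inverse (x $ i)) :: real^'a"
    have 1: "x \<bullet> ?v = real (l0norm x)"
      unfolding inn l0norm_def by (simp add: supp_def)
    have 2: "(\<Sum>i\<in>supp x. (x $ i * ?v $ i)\<^sup>2) = real (l0norm x)"
      unfolding l0norm_def by (simp add: supp_def)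
    have "x \<noteq> 0" using n by auto
    then have "supp x \<noteq> {}" by (auto simp: supp_def vec_eq_iff)
    then have pos: "real (l0norm x) > 0"
      by (simp add: l0norm_def card_gt_0_iff)
    have "real (l0norm x) * real (l0norm x) \<le> real k * real (l0norm x)"
      using le[rule_format, of ?v] unfolding 1 2 by (simp add: power2_eq_square)
    with pos show ?thesis by simp
  qed
  moreover have "(x \<bullet> v)\<^sup>2 \<le> real k * (\<Sum>i\<in>supp x. (x $ i * v $ i)\<^sup>2)"
    if "l0norm x \<le> k" for v
  proof -
    have "(x \<bullet> v)\<^sup>2 \<le> (\<Sum>i\<in>supp x. (x $ i * v $ i)\<^sup>2) * real (card (supp x))"
      using Cauchy_Schwarz_ineq_sum[of "\<lambda>i. x $ i * v $ i" "\<lambda>_. 1" "supp x"]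
      unfolding inn by simp
    also have "\<dots> \<le> (\<Sum>i\<in>supp x. (x $ i * v $ i)\<^sup>2) * real k"
      using that by (intro mult_left_mono sum_nonneg) (auto simp: l0norm_def)
    finally show ?thesis by (simp add: mult.commute)
  qed
  ultimately show ?thesis
    unfolding sdp_feasible_iff diag outer_inner trace_outer
    by (auto simp: sym_mats_outer)
qed

theorem sdp_exact_spca_optimal:
  assumes "sdp_exact \<Sigma> k" and "sdp_optimal \<Sigma> k X"
  obtains x where "X = outer x" and "l0norm x \<le> k" and "spca_optimal \<Sigma> k x"
proof -
  obtain x where x: "X = outer x"
    using assms unfolding sdp_exact_def by blast
  have opt: "outer x \<in> sdp_feasible k"
    "\<And>Y. Y \<in> sdp_feasible k \<Longrightarrow> mat_inner \<Sigma> Y \<le> mat_inner \<Sigma> (outer x)"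
    using assms(2) unfolding x sdp_optimal_def is_arg_max_linorder by auto
  have "y \<bullet> (\<Sigma> *v y) \<le> x \<bullet> (\<Sigma> *v x)" if "l0norm y \<le> k" "(norm y)\<^sup>2 = 1" for y
    using opt(2)[of "outer y"] that unfolding mat_inner_outer outer_feasible_iff by blast
  then have "spca_optimal \<Sigma> k x"
    using opt(1) unfolding spca_optimal_def is_arg_max_linorder outer_feasible_iff by blast
  with that x opt(1) show thesis unfolding outer_feasible_iff by blast
qed

lemma compact_sdp_feasible: "compact (sdp_feasible k :: (real^'n^'n) set)"
proof -
  let ?F = "sdp_feasible k :: (real^'n^'n) set"
  have "?F = {X. transpose X = X} \<inter> {X. trace X = 1} \<inter>
      (\<Inter>v. {X. 0 \<le> v \<bullet> (X *v v)}) \<inter>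
      (\<Inter>v. {X. v \<bullet> (X *v v) \<le> real k * (\<Sum>i\<in>UNIV. X $ i $ i * (v $ i)\<^sup>2)})"
    unfolding set_eq_iff sdp_feasible_iff by (auto simp: sym_mats_def)
  moreover have "closed {X :: real^'n^'n. transpose X = X}"
    unfolding transpose_def by (intro closed_Collect_eq continuous_intros)
  moreover have "closed {X :: real^'n^'n. trace X = 1}"
    unfolding trace_def by (intro closed_Collect_eq continuous_intros)
  moreover have "closed {X :: real^'n^'n. 0 \<le> v \<bullet> (X *v v)}" for v
    unfolding matrix_vector_mult_def by (intro closed_Collect_le continuous_intros)
  moreover have "closed {X :: real^'n^'n.
      v \<bullet> (X *v v) \<le> real k * (\<Sum>i\<in>UNIV. X $ i $ i * (v $ i)\<^sup>2)}" for v
    unfolding matrix_vector_mult_def by (intro closed_Collect_le continuous_intros)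
  ultimately have "closed ?F" by (simp add: closed_INT closed_Int)
  moreover have "bounded ?F"
  proof -
    have "norm X \<le> (\<Sum>i\<in>(UNIV::'n set). \<Sum>j\<in>(UNIV::'n set). 1)" if "X \<in> ?F" for X
    proof -
      have sym: "X $ i $ j = X $ j $ i" for i j
        using that unfolding sdp_feasible_iff sym_mats_def
        by (metis (mono_tags, lifting) mem_Collect_eq transpose_def vec_lambda_beta)
      have pos: "0 \<le> v \<bullet> (X *v v)" for v
        using that by (simp add: sdp_feasible_iff)
      have quad: "(axis i 1 + s *\<^sub>R axis j 1) \<bullet> (X *v (axis i 1 + s *\<^sub>R axis j 1))
          = X $ i $ i + 2 * s * X $ i $ j + s\<^sup>2 * X $ j $ j" for i j s
        by (simp add: matrix_vector_mult_basis matrix_vector_right_distrib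
            matrix_vector_mult_scaleR inner_add_left inner_add_right inner_axis' column_def
            sym[of j i] power2_eq_square algebra_simps)
      have dpos: "0 \<le> X $ i $ i" for i
        using pos[of "axis i 1 + 0 *\<^sub>R axis i 1"] unfolding quad by simp
      have dle: "X $ i $ i \<le> 1" for i
        using that dpos member_le_sum[of i UNIV "\<lambda>i. X $ i $ i"]
        by (simp add: sdp_feasible_iff trace_def)
      have ent: "\<bar>X $ i $ j\<bar> \<le> 1" for i j
        using pos[of "axis i 1 + 1 *\<^sub>R axis j 1"] pos[of "axis i 1 + (-1) *\<^sub>R axis j 1"]
          dle[of i] dle[of j] unfolding quad by simp
      have "norm X \<le> (\<Sum>i\<in>UNIV. norm (X $ i))"
        unfolding norm_vec_def[of X] by (intro L2_set_le_sum) simp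
      also have "\<dots> \<le> (\<Sum>i\<in>UNIV. \<Sum>j\<in>UNIV. \<bar>X $ i $ j\<bar>)"
        by (intro sum_mono norm_le_l1_cart)
      also have "\<dots> \<le> (\<Sum>i\<in>(UNIV::'n set). \<Sum>j\<in>(UNIV::'n set). 1)"
        by (intro sum_mono ent)
      finally show ?thesis .
    qed
    then show ?thesis unfolding bounded_iff by blast
  qed
  ultimately show ?thesis by (simp add: compact_eq_bounded_closed)
qed

theorem sdp_optimal_exists:
  fixes \<Sigma> :: "real^'n^'n"
  assumes "k \<ge> 1"
  obtains X where "sdp_optimal \<Sigma> k X"
proof -
  obtain i :: 'n where True by simp
  have "supp (axis i 1 :: real^'n) = {i}"
    by (auto simp: supp_def axis_def)
  then have "outer (axis i 1) \<in> sdp_feasible k"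
    unfolding outer_feasible_iff using assms by (simp add: l0norm_def)
  then have "sdp_feasible k \<noteq> ({} :: (real^'n^'n) set)" by blast
  moreover have "continuous_on (sdp_feasible k) (mat_inner \<Sigma>)"
    unfolding mat_inner_eq_inner[abs_def] by (intro continuous_intros)
  ultimately obtain X where "X \<in> sdp_feasible k"
    "\<forall>Y\<in>sdp_feasible k. mat_inner \<Sigma> Y \<le> mat_inner \<Sigma> X"
    using continuous_attains_sup[OF compact_sdp_feasible] by blast
  with that show thesis
    unfolding sdp_optimal_def is_arg_max_linorder by blast
qed

end

theory Submission
  imports Defs
begin

text \<open>Up to scaling and a shift by a multiple of the identity, which is constant on the feasible set,
  \<open>\<Sigma>\<close> is \<open>M = outer xbar + E\<close> with \<open>\<parallel>E\<parallel> < c/16\<close>. Let \<open>x\<close> be a top unit eigenvector of the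
  principal submatrix of \<open>M\<close> on \<open>S = supp xbar\<close>, with eigenvalue \<open>l\<close>. Since \<open>x\<close> is close to \<open>xbar\<close>,
  its support is exactly \<open>S\<close>. A dual multiplier \<open>(\<kappa>/k) y y\<^sup>T\<close> of the constraint \<open>k diag(X) - X \<succeq> 0\<close> is
  complementary to \<open>x x\<^sup>T\<close> iff \<open>x\<^sub>i y\<^sub>i\<close> does not depend on \<open>i \<in> S\<close>, which suggests \<open>y\<^sub>i = 1/x\<^sub>i\<close> there.
  The remaining entries of \<open>y\<close> are then forced by the requirement that the slack matrix
  \<open>Z = l I - M - \<kappa> diag(y y\<^sup>T) + (\<kappa>/k) y y\<^sup>T\<close> annihilates \<open>x\<close>. For \<open>\<kappa> = c\<^sup>2/8\<close> all \<open>\<kappa> y\<^sub>i\<^sup>2\<close> are at most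
  \<open>1/2\<close>, while the second eigenvalue of \<open>M\<close> is small, so \<open>Z\<close> is positive definite on the
  complement of \<open>x\<close>. Hence \<open>x x\<^sup>T\<close> is the only optimal solution.\<close>

section \<open>Positive semidefinite matrices\<close>

lemma sym_mats_inner_commute:
  assumes "A \<in> sym_mats"
  shows "u \<bullet> (A *v v) = v \<bullet> (A *v u)"
proof -
  have "u \<bullet> (A *v v) = (u v* A) \<bullet> v" by (simp add: dot_lmul_matrix)
  also have "u v* A = A *v u"
    using assms by (metis (mono_tags, lifting) sym_mats_def mem_Collect_eq transpose_matrix_vector)
  finally show ?thesis by (simp add: inner_commute)
qed

lemma quadratic_form_add_scaleR:
  assumes "A \<in> sym_mats"
  shows "(u + r *\<^sub>R v) \<bullet> (A *v (u + r *\<^sub>R v))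
    = u \<bullet> (A *v u) + 2 * r * (u \<bullet> (A *v v)) + r\<^sup>2 * (v \<bullet> (A *v v))"
  using sym_mats_inner_commute[OF assms, of v u]
  by (simp add: matrix_vector_right_distrib matrix_vector_mult_scaleR inner_add_left
      inner_add_right power2_eq_square algebra_simps)

text \<open>For nonzero \<open>c\<close> the minimiser \<open>r = - b / c\<close> gives the bound.
  For \<open>c = 0\<close> an affine function of \<open>r\<close> that is nonnegative everywhere has
  slope zero.\<close>

lemma quadratic_nonneg_imp_discriminant_le:
  fixes a b c :: real
  assumes c: "0 \<le> c" and nn: "\<And>r. 0 \<le> a + 2 * r * b + r\<^sup>2 * c"
  shows "b\<^sup>2 \<le> a * c"
proof (cases "c = 0")
  case False
  have "a + 2 * (- b / c) * b + (- b / c)\<^sup>2 * c = a - b\<^sup>2 / c"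
    using False by (simp add: field_simps power2_eq_square)
  with nn[of "- b / c"] have "b\<^sup>2 / c \<le> a" by simp
  then show ?thesis using c False by (simp add: field_simps)
next
  case True
  have "b = 0"
  proof (rule ccontr)
    assume "b \<noteq> 0"
    then have "a + 2 * (- (a + 1) / b) * b < 0" using nn[of 0] by simp
    with nn[of "- (a + 1) / b"] True show False by simp
  qed
  with True show ?thesis by simp
qed

lemma psd_Cauchy_Schwarz:
  assumes "psd A"
  shows "(u \<bullet> (A *v v))\<^sup>2 \<le> (u \<bullet> (A *v u)) * (v \<bullet> (A *v v))"
proof (rule quadratic_nonneg_imp_discriminant_le)
  show "0 \<le> v \<bullet> (A *v v)" using assms by (simp add: psd_def)
next
  fix r
  have "0 \<le> (u + r *\<^sub>R v) \<bullet> (A *v (u + r *\<^sub>R v))"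
    using assms by (simp add: psd_def)
  then show "0 \<le> u \<bullet> (A *v u) + 2 * r * (u \<bullet> (A *v v)) + r\<^sup>2 * (v \<bullet> (A *v v))"
    using assms by (simp add: psd_def quadratic_form_add_scaleR)
qed

lemma inner_axis_mult_axis: "axis i 1 \<bullet> (A *v axis j 1) = (A :: real^'n^'n) $ i $ j"
  by (simp add: matrix_vector_mult_basis inner_axis' column_def)

lemma psd_diag_nonneg: "psd A \<Longrightarrow> 0 \<le> A $ i $ i"
  using inner_axis_mult_axis[of i A i] by (metis psd_def)

lemma psd_diag_zero_imp_zero:
  assumes "psd A" "A $ j $ j = 0"
  shows "A $ i $ j = 0"
  using psd_Cauchy_Schwarz[OF assms(1), of "axis i 1" "axis j 1"] assms(2)
  by (simp add: inner_axis_mult_axis)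

text \<open>Induction on the number of nonzero diagonal entries of \<open>X\<close>: subtracting the rank-one matrix
  built from a column with nonzero pivot leaves the Schur complement, which is again positive
  semidefinite and has one nonzero diagonal entry less.\<close>

lemma inner_psd_nonneg:
  fixes P X :: "real^'n^'n"
  assumes "\<And>v. 0 \<le> v \<bullet> (P *v v)" and "psd X"
  shows "0 \<le> P \<bullet> X"
  using assms(2)
proof (induction "card {i. X $ i $ i \<noteq> 0}" arbitrary: X rule: less_induct)
  case less
  show ?case
  proof (cases "\<exists>i. X $ i $ i \<noteq> 0")
    case False
    then have "X = 0"
      using psd_diag_zero_imp_zero[OF less.prems] by (simp add: vec_eq_iff)
    then show ?thesis by simp
  next
    case True
    then obtain i where i: "X $ i $ i \<noteq> 0" by blast
    then have ipos: "X $ i $ i > 0" using psd_diag_nonneg[OF less.prems, of i] by simp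
    define w where "w = X *v axis i 1"
    define X' where "X' = X - (1 / X $ i $ i) *\<^sub>R outer w"
    have w: "w $ j = X $ j $ i" for j
      by (simp add: w_def matrix_vector_mult_basis column_def)
    have symX: "X \<in> sym_mats" using less.prems by (simp add: psd_def)
    have X'v: "v \<bullet> (X' *v v) = v \<bullet> (X *v v) - (w \<bullet> v)\<^sup>2 / X $ i $ i" for v
      by (simp add: X'_def matrix_vector_mult_diff_rdistrib inner_diff_right
          scaleR_matrix_vector_assoc[symmetric] outer_inner)
    \<comment> \<open>This is Cauchy-Schwarz for the form of \<open>X\<close>, applied to
      \<open>v\<close> and the pivot axis.\<close>
    have "0 \<le> v \<bullet> (X' *v v)" for v
      using psd_Cauchy_Schwarz[OF less.prems, of v "axis i 1"] ipos
      unfolding X'v by (simp add: inner_axis_mult_axis w_def inner_commute field_simps)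
    moreover have "X' \<in> sym_mats"
      using symX by (simp add: X'_def sym_mats_def transpose_def outer_def vec_eq_iff mult.commute)
    ultimately have X': "psd X'" by (simp add: psd_def)
    have "X' $ i $ i = 0"
      using i by (simp add: X'_def outer_def w)
    moreover have "X' $ j $ j = 0" if "X $ j $ j = 0" for j
    proof -
      have "X $ j $ i = X $ i $ j"
        using sym_mats_inner_commute[OF symX, of "axis j 1" "axis i 1"]
        by (simp only: inner_axis_mult_axis)
      also have "\<dots> = 0" by (rule psd_diag_zero_imp_zero[OF less.prems that])
      finally show ?thesis using that by (simp add: X'_def outer_def w)
    qed
    ultimately have "{j. X' $ j $ j \<noteq> 0} \<subset> {j. X $ j $ j \<noteq> 0}"
      using i by blast
    then have "card {j. X' $ j $ j \<noteq> 0} < card {j. X $ j $ j \<noteq> 0}"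
      by (intro psubset_card_mono) auto
    then have "0 \<le> P \<bullet> X'" using less.hyps X' by blast
    moreover have "P \<bullet> X = P \<bullet> X' + (w \<bullet> (P *v w)) / X $ i $ i"
      by (simp add: X'_def inner_diff_right mat_inner_eq_inner[symmetric] mat_inner_outer
          inner_right_distrib)
         (simp add: mat_inner_eq_inner inner_diff_right flip: mat_inner_outer)
    ultimately show ?thesis using assms(1)[of w] ipos by simp
  qed
qed

section \<open>Trace inner products and rank-one matrices\<close>

lemma inner_outer_left: "outer x \<bullet> A = x \<bullet> (A *v x)"
  by (metis inner_commute mat_inner_eq_inner mat_inner_outer)

lemma inner_mat_1_left: "mat 1 \<bullet> A = trace (A :: real^'n^'n)"
  by (simp add: inner_vec_def mat_def trace_def if_distrib if_distribR cong: if_cong)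

lemma inner_diag_part_outer_left: "diag_part (outer y) \<bullet> A = (\<Sum>i\<in>UNIV. A $ i $ i * (y $ i)\<^sup>2)"
  by (simp add: inner_vec_def diag_part_def outer_def if_distrib if_distribR power2_eq_square
      ac_simps cong: if_cong)

text \<open>By Cauchy-Schwarz \<open>(norm v)\<^sup>2 *\<^sub>R mat 1 - outer v\<close> has a
  nonnegative form, so its trace product with \<open>X\<close> is nonnegative.\<close>

lemma psd_quadratic_form_le_trace:
  fixes X :: "real^'n^'n"
  assumes "psd X"
  shows "v \<bullet> (X *v v) \<le> trace X * (norm v)\<^sup>2"
proof -
  have "0 \<le> ((norm v)\<^sup>2 *\<^sub>R mat 1 - outer v) \<bullet> X"
  proof (rule inner_psd_nonneg[OF _ assms])
    fix u :: "real^'n"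
    have "(v \<bullet> u)\<^sup>2 \<le> (v \<bullet> v) * (u \<bullet> u)" by (rule Cauchy_Schwarz_ineq)
    then show "0 \<le> u \<bullet> (((norm v)\<^sup>2 *\<^sub>R mat 1 - outer v) *v u)"
      by (simp add: matrix_vector_mult_diff_rdistrib inner_diff_right
          scaleR_matrix_vector_assoc[symmetric] outer_inner power2_norm_eq_inner)
  qed
  then show ?thesis
    by (simp add: inner_diff_left inner_outer_left inner_mat_1_left mult.commute)
qed

text \<open>The squared Frobenius distance of \<open>X\<close> and \<open>outer x\<close> is
  \<open>X \<bullet> X - 2 * (x \<bullet> (X *v x)) + 1\<close>. It is nonpositive because
  \<open>X \<bullet> X \<le> trace X\<close>, all eigenvalues of \<open>X\<close> being at most
  1.\<close>

lemma psd_eq_outer: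
  fixes X :: "real^'n^'n"
  assumes X: "psd X" and tr: "trace X = 1" and x: "norm x = 1" and ge: "x \<bullet> (X *v x) \<ge> 1"
  shows "X = outer x"
proof -
  have "0 \<le> (mat 1 - X) \<bullet> X"
  proof (rule inner_psd_nonneg[OF _ X])
    show "0 \<le> v \<bullet> ((mat 1 - X) *v v)" for v
      using psd_quadratic_form_le_trace[OF X, of v] tr
      by (simp add: matrix_vector_mult_diff_rdistrib inner_diff_right power2_norm_eq_inner)
  qed
  then have "X \<bullet> X \<le> 1" by (simp add: inner_diff_left inner_mat_1_left tr)
  moreover have "outer x \<bullet> outer x = 1"
    unfolding inner_outer_left outer_inner power2_norm_eq_inner[of x, symmetric] using x by simp
  moreover have "outer x \<bullet> X \<ge> 1" "X \<bullet> outer x \<ge> 1"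
    using ge by (simp_all add: inner_outer_left inner_commute[of X])
  ultimately have "(X - outer x) \<bullet> (X - outer x) \<le> 0"
    by (simp add: inner_diff_left inner_diff_right)
  then show ?thesis by (metis inner_gt_zero_iff not_le right_minus_eq)
qed

lemma rank_outer:
  fixes x :: "real^'n"
  assumes "x \<noteq> 0"
  shows "rank (outer x) = 1"
proof -
  obtain j where j: "x $ j \<noteq> 0" using assms by (auto simp: vec_eq_iff)
  have col: "column i (outer x) = x $ i *\<^sub>R x" for i
    by (simp add: column_def outer_def vec_eq_iff mult.commute)
  have "span (columns (outer x)) = span {x}"
  proof (rule span_eq[THEN iffD2], intro conjI subsetI)
    fix z assume "z \<in> columns (outer x)"
    then show "z \<in> span {x}" by (auto simp: columns_def col span_base span_scale)
  next
    fix z assume "z \<in> {x}"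
    then have "z = (1 / x $ j) *\<^sub>R column j (outer x)" using j by (simp add: col)
    moreover have "column j (outer x) \<in> columns (outer x)" by (auto simp: columns_def)
    ultimately show "z \<in> span (columns (outer x))" by (simp add: span_base span_scale)
  qed
  then have "dim (columns (outer x)) = dim {x}" by (metis dim_span)
  then show ?thesis using assms by (simp add: column_rank_def dim_insert)
qed



section \<open>The dual certificate\<close>

text \<open>\<open>x\<close> maximises the quadratic form of \<open>M\<close> over the unit vectors
  supported in \<open>S\<close>, and \<open>l\<close> is the maximum. Optimality only yields the
  eigenvector equation in the rows of \<open>S\<close>.\<close>

lemma restricted_top_eigenvector:
  fixes M :: "real^'n^'n"
  assumes M: "M \<in> sym_mats" and S: "S \<noteq> {}"
  obtains x l where "norm x = 1" "supp x \<subseteq> S"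
    "\<And>v. supp v \<subseteq> S \<Longrightarrow> v \<bullet> (M *v v) \<le> l * (norm v)\<^sup>2"
    "\<And>i. i \<in> S \<Longrightarrow> (M *v x) $ i = l * x $ i"
proof -
  define K where "K = sphere (0 :: real^'n) 1 \<inter> (\<Inter>i\<in>-S. {v. v $ i = 0})"
  have K: "v \<in> K \<longleftrightarrow> norm v = 1 \<and> supp v \<subseteq> S" for v
    by (auto simp: K_def supp_def)
  have "closed {v :: real^'n. v $ i = 0}" for i
    by (intro closed_Collect_eq continuous_intros)
  then have cK: "compact K"
    unfolding K_def by (intro compact_Int_closed closed_INT ballI compact_sphere) auto
  obtain i0 where "i0 \<in> S" using S by blast
  then have "supp (axis i0 1 :: real^'n) \<subseteq> S" by (auto simp: supp_def axis_def)
  then have "axis i0 1 \<in> K" by (simp add: K)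
  then have neK: "K \<noteq> {}" by blast
  have "continuous_on K (\<lambda>v. v \<bullet> (M *v v))"
    unfolding matrix_vector_mult_def by (intro continuous_intros)
  from continuous_attains_sup[OF cK neK this]
  obtain x where x: "x \<in> K" "\<And>v. v \<in> K \<Longrightarrow> v \<bullet> (M *v v) \<le> x \<bullet> (M *v x)"
    by blast
  define l where "l = x \<bullet> (M *v x)"
  have le: "v \<bullet> (M *v v) \<le> l * (norm v)\<^sup>2" if v: "supp v \<subseteq> S" for v
  proof (cases "v = 0")
    case False
    then have "(1 / norm v) *\<^sub>R v \<in> K" using v by (auto simp: K supp_def)
    from x(2)[OF this] have "(v \<bullet> (M *v v)) / (norm v)\<^sup>2 \<le> l"
      by (simp add: l_def matrix_vector_mult_scaleR power2_eq_square)
    then show ?thesis using False by (simp add: field_simps)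
  qed simp
  define A where "A = l *\<^sub>R mat 1 - M"
  have Amult: "A *v v = l *\<^sub>R v - M *v v" for v
    by (simp add: A_def matrix_vector_mult_diff_rdistrib scaleR_matrix_vector_assoc[symmetric])
  have Asym: "A \<in> sym_mats"
    using M by (auto simp: A_def sym_mats_def transpose_def mat_def vec_eq_iff)
  have Ann: "0 \<le> v \<bullet> (A *v v)" if "supp v \<subseteq> S" for v
    using le[OF that] by (simp add: Amult inner_diff_right power2_norm_eq_inner)
  have Ax: "x \<bullet> (A *v x) = 0"
    using x(1) by (simp add: Amult inner_diff_right K l_def flip: power2_norm_eq_inner)
  have "(M *v x) $ i = l * x $ i" if i: "i \<in> S" for i
  proof -
    \<comment> \<open>\<open>A\<close> need not be positive semidefinite, so
      \<open>psd_Cauchy_Schwarz\<close> does not apply; but the line through \<open>x\<close> in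
      direction \<open>axis i 1\<close> stays among the vectors supported in \<open>S\<close>, where
      the form is nonnegative.\<close>
    have "(x \<bullet> (A *v axis i 1))\<^sup>2 \<le> 0 * (axis i 1 \<bullet> (A *v axis i 1))"
    proof (rule quadratic_nonneg_imp_discriminant_le)
      show "0 \<le> axis i 1 \<bullet> (A *v axis i 1)"
        using i by (intro Ann) (auto simp: supp_def axis_def)
    next
      fix r
      have "supp (x + r *\<^sub>R axis i 1) \<subseteq> S"
        using i x(1) by (auto simp: K supp_def axis_def)
      from Ann[OF this]
      show "0 \<le> 0 + 2 * r * (x \<bullet> (A *v axis i 1)) + r\<^sup>2 * (axis i 1 \<bullet> (A *v axis i 1))"
        by (simp add: quadratic_form_add_scaleR[OF Asym] Ax)
    qed
    then have "axis i 1 \<bullet> (A *v x) = 0"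
      using sym_mats_inner_commute[OF Asym, of "axis i 1" x] by simp
    then show ?thesis by (simp add: Amult inner_axis')
  qed
  with that[of x l] le x(1) show thesis by (auto simp: K)
qed

text \<open>\<open>(\<kappa> / k) *\<^sub>R outer y\<close> is the multiplier of the constraint \<open>k diag(X) - X \<succeq> 0\<close>; the
  matrix below is then the multiplier of \<open>X \<succeq> 0\<close>.\<close>

definition dual_slack :: "real \<Rightarrow> real^'n^'n \<Rightarrow> real \<Rightarrow> nat \<Rightarrow> real^'n \<Rightarrow> real^'n^'n" where
  "dual_slack l M \<kappa> k y =
     l *\<^sub>R mat 1 - M - \<kappa> *\<^sub>R diag_part (outer y) + (\<kappa> / real k) *\<^sub>R outer y"

lemma sym_mats_dual_slack: "M \<in> sym_mats \<Longrightarrow> dual_slack l M \<kappa> k y \<in> sym_mats"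
  by (auto simp: dual_slack_def sym_mats_def transpose_def mat_def vec_eq_iff diag_part_def
      outer_def)

lemma dual_slack_mult:
  "(dual_slack l M \<kappa> k y *v v) $ i
    = l * v $ i - (M *v v) $ i - \<kappa> * (y $ i)\<^sup>2 * v $ i + \<kappa> / real k * (y \<bullet> v) * y $ i"
proof -
  have "(diag_part (outer y) *v v) $ i = (y $ i)\<^sup>2 * v $ i"
    by (simp add: matrix_vector_mult_def diag_part_def outer_def if_distrib if_distribR
        power2_eq_square cong: if_cong)
  moreover have "(outer y *v v) $ i = (y \<bullet> v) * y $ i"
    by (simp add: matrix_vector_mult_def outer_def inner_vec_def sum_distrib_left
        sum_distrib_right ac_simps)
  ultimately show ?thesis
    by (simp add: dual_slack_def matrix_vector_mult_diff_rdistrib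
        matrix_vector_mult_add_rdistrib scaleR_matrix_vector_assoc[symmetric])
qed

lemma dual_slack_quadratic_form:
  "v \<bullet> (dual_slack l M \<kappa> k y *v v) = l * (norm v)\<^sup>2 - v \<bullet> (M *v v)
    - \<kappa> * (\<Sum>i\<in>UNIV. (y $ i)\<^sup>2 * (v $ i)\<^sup>2) + \<kappa> / real k * (y \<bullet> v)\<^sup>2"
proof -
  have "(\<Sum>i\<in>UNIV. outer y $ i $ i * (v $ i)\<^sup>2) = (\<Sum>i\<in>UNIV. (y $ i)\<^sup>2 * (v $ i)\<^sup>2)"
    by (simp add: outer_def power2_eq_square)
  then show ?thesis
    by (simp add: dual_slack_def matrix_vector_mult_diff_rdistrib matrix_vector_mult_add_rdistrib
        inner_diff_right inner_add_right scaleR_matrix_vector_assoc[symmetric] outer_inner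
        diag_part_inner power2_norm_eq_inner)
qed

text \<open>Weak duality with a strict gap. Pairing \<open>cert\<close> with \<open>X\<close> bounds
  \<open>\<delta> * (1 - x \<bullet> (X *v x))\<close> by \<open>Z \<bullet> X\<close>, which is
  \<open>l - mat_inner M X\<close> minus a nonnegative multiple of the constraint slack
  \<open>g\<close>, hence nonpositive.\<close>

lemma feasible_eq_outer_of_dual_certificate:
  fixes M X :: "real^'n^'n"
  assumes k: "k > 0" and \<kappa>: "\<kappa> \<ge> 0" and \<delta>: "\<delta> > 0" and x: "norm x = 1"
    and cert: "\<And>v. \<delta> * ((norm v)\<^sup>2 - (x \<bullet> v)\<^sup>2) \<le> v \<bullet> (dual_slack l M \<kappa> k y *v v)"
    and X: "X \<in> sdp_feasible k" and opt: "mat_inner M X \<ge> l"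
  shows "X = outer x"
proof -
  define Z where "Z = dual_slack l M \<kappa> k y"
  define g where "g = real k * (\<Sum>i\<in>UNIV. X $ i $ i * (y $ i)\<^sup>2) - y \<bullet> (X *v y)"
  have Xpsd: "psd X" and tr: "trace X = 1" and g: "g \<ge> 0"
    using X by (auto simp: sdp_feasible_iff psd_def g_def)
  have "0 \<le> (Z - \<delta> *\<^sub>R (mat 1 - outer x)) \<bullet> X"
  proof (rule inner_psd_nonneg[OF _ Xpsd])
    show "0 \<le> v \<bullet> ((Z - \<delta> *\<^sub>R (mat 1 - outer x)) *v v)" for v
      using cert[of v]
      by (simp add: Z_def matrix_vector_mult_diff_rdistrib inner_diff_right
          scaleR_matrix_vector_assoc[symmetric] outer_inner power2_norm_eq_inner)
  qed
  moreover have "Z \<bullet> X = l - mat_inner M X - \<kappa> / real k * g"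
    using k by (simp add: Z_def g_def dual_slack_def inner_diff_left inner_add_left
        inner_mat_1_left inner_outer_left inner_diag_part_outer_left tr mat_inner_eq_inner
        algebra_simps)
  moreover have "0 \<le> \<kappa> / real k * g"
    using g \<kappa> by simp
  ultimately have "0 \<le> - (\<delta> * (1 - x \<bullet> (X *v x)))"
    using opt by (simp add: inner_diff_left inner_mat_1_left inner_outer_left tr)
  then have "x \<bullet> (X *v x) \<ge> 1"
    using \<delta> by (simp add: mult_le_0_iff)
  with psd_eq_outer[OF Xpsd tr x] show ?thesis .
qed

section \<open>Exactness for a small perturbation of \<open>outer xbar\<close>\<close>

lemma sdp_optimal_eq_outer_of_rank_one_perturbation:
  fixes E :: "real^'n^'n" and xbar :: "real^'n"
  assumes nxbar: "norm xbar = 1" and k: "l0norm xbar = k"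
    and c: "c > 0" "\<And>i. i \<in> supp xbar \<Longrightarrow> c \<le> \<bar>xbar $ i\<bar>"
    and Esym: "E \<in> sym_mats" and E: "\<And>u v. \<bar>u \<bullet> (E *v v)\<bar> \<le> \<epsilon> * norm u * norm v"
    and \<epsilon>: "0 \<le> \<epsilon>" "16 * \<epsilon> \<le> c"
    and opt: "sdp_optimal (outer xbar + E) k X"
  obtains x where "norm x = 1" "X = outer x"
proof -
  define S where "S = supp xbar"
  define M where "M = outer xbar + E"
  have "xbar \<noteq> 0" using nxbar by auto
  then have S: "S \<noteq> {}" by (auto simp: S_def supp_def vec_eq_iff)
  then have kpos: "k > 0" using k by (auto simp: S_def l0norm_def card_gt_0_iff)
  have c1: "c \<le> 1"
    using S c(2) component_le_norm_cart[of xbar] nxbar unfolding S_def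
    by (metis all_not_in_conv order_trans real_norm_def)
  have Msym: "M \<in> sym_mats"
    using Esym sym_mats_outer[of xbar] by (auto simp: M_def sym_mats_def transpose_def vec_eq_iff)
  have Mmult: "(M *v v) = (xbar \<bullet> v) *\<^sub>R xbar + E *v v" for v
  proof -
    have "outer xbar *v v = (xbar \<bullet> v) *\<^sub>R xbar"
      by (simp add: vec_eq_iff matrix_vector_mult_def outer_def inner_vec_def sum_distrib_left
          sum_distrib_right ac_simps)
    then show ?thesis by (simp add: M_def matrix_vector_mult_add_rdistrib)
  qed
  have Mquad: "v \<bullet> (M *v v) = (xbar \<bullet> v)\<^sup>2 + v \<bullet> (E *v v)" for v
    by (simp add: Mmult inner_add_right power2_eq_square inner_commute)
  obtain x l where x: "norm x = 1" "supp x \<subseteq> S"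
    and l: "\<And>v. supp v \<subseteq> S \<Longrightarrow> v \<bullet> (M *v v) \<le> l * (norm v)\<^sup>2"
    and eig: "\<And>i. i \<in> S \<Longrightarrow> (M *v x) $ i = l * x $ i"
    using restricted_top_eigenvector[OF Msym S] by blast
  have xx: "x \<bullet> x = 1" and xb: "xbar \<bullet> xbar = 1"
    using x(1) nxbar by (simp_all flip: power2_norm_eq_inner)
  have x0: "x $ i = 0" "xbar $ i = 0" if "i \<notin> S" for i
    using that x(2) by (auto simp: S_def supp_def)
  have restr: "v \<bullet> (M *v x) = l * (v \<bullet> x)" if "supp v \<subseteq> S" for v
  proof -
    have "v $ i * (M *v x) $ i = l * (v $ i * x $ i)" for i
      using eig[of i] that by (cases "i \<in> S") (auto simp: supp_def)
    then show ?thesis by (simp only: inner_vec_def inner_real_def sum_distrib_left)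
  qed
  \<comment> \<open>The test vector \<open>xbar\<close> has value at least
    \<open>1 - \<epsilon>\<close>.\<close>
  have l1: "l \<ge> 15/16"
    using l[of xbar] E[of xbar xbar] nxbar xb \<epsilon> c1 by (simp add: S_def Mquad)
  define s where "s = xbar \<bullet> x"
  define p where "p = x - s *\<^sub>R xbar"
  have p_xbar: "p \<bullet> xbar = 0"
    by (simp add: p_def inner_diff_left s_def xb inner_commute[of x])
  have xp: "x = s *\<^sub>R xbar + p" by (simp add: p_def)
  have px: "p \<bullet> x = (norm p)\<^sup>2"
    using p_xbar by (subst xp) (simp add: inner_add_right power2_norm_eq_inner)
  have s2: "s\<^sup>2 = 1 - (norm p)\<^sup>2"
    using px xx by (simp add: p_def inner_diff_left s_def power2_eq_square)
  have "p $ i = 0" if "i \<notin> S" for i using x0[OF that] by (simp add: p_def)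
  then have pS: "supp p \<subseteq> S" by (auto simp: supp_def)
  have normp: "norm p \<le> c / 15"
  proof (cases "p = 0")
    case False
    \<comment> \<open>Pairing the eigenvector equation with \<open>p\<close>, which is supported in
      \<open>S\<close>, removes the rank-one part of \<open>M\<close> because \<open>p\<close> is
      orthogonal to \<open>xbar\<close>.\<close>
    have "l * (norm p)\<^sup>2 = p \<bullet> (E *v x)"
      using restr[OF pS] px p_xbar by (simp add: Mmult inner_add_right)
    also have "\<dots> \<le> \<epsilon> * norm p" using E[of p x] x(1) by simp
    finally have "l * norm p \<le> \<epsilon>" using False by (simp add: power2_eq_square)
    moreover have "15/16 * norm p \<le> l * norm p" using l1 by (intro mult_right_mono) auto
    ultimately show ?thesis using \<epsilon> by linarith
  qed (use c in simp)
  have p2: "(norm p)\<^sup>2 \<le> 1/225"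
    using power_mono[of "norm p" "1/15" 2] normp c1 by (simp add: power2_eq_square)
  have s_ge: "\<bar>s\<bar> \<ge> 9/10"
  proof (rule power2_le_imp_le)
    show "(9/10)\<^sup>2 \<le> \<bar>s\<bar>\<^sup>2" using s2 p2 by (simp add: power2_eq_square)
  qed simp
  have xi: "\<bar>x $ i\<bar> \<ge> c / 2" if "i \<in> S" for i
  proof -
    have "9/10 * c \<le> \<bar>s\<bar> * \<bar>xbar $ i\<bar>"
      using s_ge c that by (intro mult_mono) (auto simp: S_def)
    moreover have "\<bar>p $ i\<bar> \<le> c / 15"
      using component_le_norm_cart[of p i] normp by simp
    moreover have "x $ i = s * xbar $ i + p $ i" by (simp add: p_def)
    ultimately show ?thesis using c unfolding abs_mult[symmetric] by linarith
  qed
  \<comment> \<open>On \<open>S\<close> the bound \<open>xi\<close> gives \<kappa> / x_i^2 \<le> 4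
    \<kappa> / c^2, which this choice makes 1/2. Off \<open>S\<close> the value is (E x)_i^2 /
    \<kappa>, at most 1/32.\<close>
  define \<kappa> where "\<kappa> = c\<^sup>2 / 8"
  have \<kappa>: "\<kappa> > 0" using c by (simp add: \<kappa>_def)
  \<comment> \<open>Off \<open>S\<close> both \<open>x\<close> and \<open>xbar\<close> vanish and
    \<open>y \<bullet> x = k\<close>, so row \<open>i\<close> of \<open>Z *v x\<close> is
    \<open>\<kappa> * y $ i - (E *v x) $ i\<close>; setting it to zero determines
    \<open>y $ i\<close>.\<close>
  define y :: "real^'n" where "y = (\<chi> i. if i \<in> S then 1 / x $ i else (E *v x) $ i / \<kappa>)"
  have y: "y $ i = (if i \<in> S then 1 / x $ i else (E *v x) $ i / \<kappa>)" for i
    by (simp add: y_def)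
  define Z where "Z = dual_slack l M \<kappa> k y"
  have xne: "x $ i \<noteq> 0" if "i \<in> S" for i using xi[OF that] c by auto
  have suppx: "supp x = S" using xne x(2) by (auto simp: supp_def)
  have yx: "y \<bullet> x = real k"
  proof -
    have "y \<bullet> x = (\<Sum>i\<in>S. 1)"
      unfolding inner_vec_def
      by (rule sum.mono_neutral_cong_right) (auto simp: y xne x0)
    then show ?thesis using k by (simp add: S_def l0norm_def)
  qed
  have Zx: "Z *v x = 0"
  proof -
    have "(Z *v x) $ i = 0" for i
      using kpos \<kappa> eig[of i] xne[of i] x0[of i]
      by (cases "i \<in> S") (simp_all add: Z_def dual_slack_mult yx y power2_eq_square Mmult)
    then show ?thesis by (simp add: vec_eq_iff)
  qed
  have Zsym: "Z \<in> sym_mats" unfolding Z_def by (rule sym_mats_dual_slack[OF Msym])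
  have \<kappa>y: "\<kappa> * (y $ i)\<^sup>2 \<le> 1/2" for i
  proof (cases "i \<in> S")
    case True
    have "(c / 2)\<^sup>2 \<le> \<bar>x $ i\<bar>\<^sup>2" using xi[OF True] c by (intro power_mono) auto
    then show ?thesis using True xne[OF True]
      by (simp add: \<kappa>_def y power_divide field_simps)
  next
    case False
    have "\<bar>(E *v x) $ i\<bar> \<le> \<epsilon>"
      using E[of "axis i 1" x] x(1) by (simp add: inner_axis')
    also have "\<dots> \<le> c / 16" using \<epsilon> by simp
    finally have "\<bar>(E *v x) $ i\<bar>\<^sup>2 \<le> (c / 16)\<^sup>2" by (intro power_mono) auto
    moreover have "\<kappa> * (y $ i)\<^sup>2 = \<bar>(E *v x) $ i\<bar>\<^sup>2 / \<kappa>"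
      using False \<kappa> by (simp add: y power2_eq_square)
    moreover have "(c / 16)\<^sup>2 / \<kappa> = 1/32" using c by (simp add: \<kappa>_def power2_eq_square)
    ultimately show ?thesis
      using \<kappa> divide_right_mono[of "\<bar>(E *v x) $ i\<bar>\<^sup>2" "(c / 16)\<^sup>2" \<kappa>] by linarith
  qed
  \<comment> \<open>The five estimates below leave 15/16 - 1/16 - 1/16 - 1/2 = 5/16, with the
    rank-one term of \<open>Z\<close> dropped as nonnegative. The overlap of \<open>u\<close> with
    \<open>xbar\<close> is small since \<open>xbar\<close> is nearly parallel to
    \<open>x\<close>.\<close>
  have Zperp: "1/4 * (norm u)\<^sup>2 \<le> u \<bullet> (Z *v u)" if u: "x \<bullet> u = 0" for u
  proof -
    have "s * (xbar \<bullet> u) = - (p \<bullet> u)"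
      using u by (subst (asm) xp) (simp add: inner_add_left)
    then have "s\<^sup>2 * (xbar \<bullet> u)\<^sup>2 = (p \<bullet> u)\<^sup>2" by (metis power2_minus power_mult_distrib)
    also have "\<dots> \<le> (norm p)\<^sup>2 * (norm u)\<^sup>2"
      using Cauchy_Schwarz_ineq[of p u] by (simp add: power2_norm_eq_inner)
    also have "\<dots> \<le> 1/225 * (norm u)\<^sup>2" using p2 by (intro mult_right_mono) auto
    finally have "s\<^sup>2 * (xbar \<bullet> u)\<^sup>2 \<le> 1/225 * (norm u)\<^sup>2" .
    moreover have "4/5 * (xbar \<bullet> u)\<^sup>2 \<le> s\<^sup>2 * (xbar \<bullet> u)\<^sup>2"
      using s2 p2 by (intro mult_right_mono) auto
    ultimately have 1: "(xbar \<bullet> u)\<^sup>2 \<le> 1/16 * (norm u)\<^sup>2"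
      using zero_le_power2[of "norm u"] by linarith
    have "u \<bullet> (E *v u) \<le> \<epsilon> * (norm u)\<^sup>2"
      using E[of u u] by (simp add: power2_eq_square)
    also have "\<dots> \<le> 1/16 * (norm u)\<^sup>2" using \<epsilon> c1 by (intro mult_right_mono) auto
    finally have 2: "u \<bullet> (E *v u) \<le> 1/16 * (norm u)\<^sup>2" .
    have "\<kappa> * (\<Sum>i\<in>UNIV. (y $ i)\<^sup>2 * (u $ i)\<^sup>2) = (\<Sum>i\<in>UNIV. (\<kappa> * (y $ i)\<^sup>2) * (u $ i)\<^sup>2)"
      by (simp add: sum_distrib_left mult.assoc)
    also have "\<dots> \<le> (\<Sum>i\<in>UNIV. 1/2 * (u $ i)\<^sup>2)"
      by (intro sum_mono mult_right_mono \<kappa>y) auto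
    also have "\<dots> = 1/2 * (norm u)\<^sup>2"
      by (simp only: sum_distrib_left[symmetric] power2_norm_eq_inner inner_vec_def)
         (simp add: power2_eq_square)
    finally have 3: "\<kappa> * (\<Sum>i\<in>UNIV. (y $ i)\<^sup>2 * (u $ i)\<^sup>2) \<le> 1/2 * (norm u)\<^sup>2" .
    have 4: "15/16 * (norm u)\<^sup>2 \<le> l * (norm u)\<^sup>2" using l1 by (intro mult_right_mono) auto
    have 5: "0 \<le> \<kappa> / real k * (y \<bullet> u)\<^sup>2" using \<kappa> by simp
    show ?thesis
      unfolding Z_def dual_slack_quadratic_form Mquad
      using 1 2 3 4 5 zero_le_power2[of "norm u"] by linarith
  qed
  \<comment> \<open>As \<open>Z *v x = 0\<close> and \<open>Z\<close> is symmetric, removing the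
    \<open>x\<close> component of \<open>v\<close> does not change the form.\<close>
  have cert: "1/4 * ((norm v)\<^sup>2 - (x \<bullet> v)\<^sup>2) \<le> v \<bullet> (dual_slack l M \<kappa> k y *v v)" for v
  proof -
    define u where "u = v - (x \<bullet> v) *\<^sub>R x"
    have v: "v = u + (x \<bullet> v) *\<^sub>R x" by (simp add: u_def)
    have u: "x \<bullet> u = 0" by (simp add: u_def inner_diff_right xx)
    have "(norm v)\<^sup>2 - (x \<bullet> v)\<^sup>2 = (norm u)\<^sup>2"
      unfolding u_def power2_norm_eq_inner
      by (simp add: inner_diff_left inner_diff_right xx inner_commute power2_eq_square)
    moreover have "v \<bullet> (Z *v v) = u \<bullet> (Z *v u)"
      using quadratic_form_add_scaleR[OF Zsym, of u "x \<bullet> v" x] by (simp add: v[symmetric] Zx)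
    ultimately show ?thesis using Zperp[OF u] by (simp add: Z_def)
  qed
  have X: "X \<in> sdp_feasible k"
    and max: "\<And>Y. Y \<in> sdp_feasible k \<Longrightarrow> mat_inner M Y \<le> mat_inner M X"
    using opt unfolding sdp_optimal_def is_arg_max_linorder M_def by auto
  \<comment> \<open>\<open>outer x\<close> attains the value \<open>l\<close>, so every optimal
    \<open>X\<close> has value at least \<open>l\<close>.\<close>
  have "outer x \<in> sdp_feasible k"
    using suppx k x(1) by (simp add: outer_feasible_iff l0norm_def S_def)
  from max[OF this] have "l \<le> mat_inner M X"
    using restr[OF x(2)] by (simp add: mat_inner_outer xx)
  with that x(1) feasible_eq_outer_of_dual_certificate[OF kpos _ _ x(1) cert X] \<kappa>
  show thesis by simp
qed

section \<open>Reduction to the normalised perturbation\<close>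

lemma sdp_optimal_scaleR_add_mat_1:
  fixes M :: "real^'n^'n"
  assumes "r > 0"
  shows "sdp_optimal (r *\<^sub>R M + s *\<^sub>R mat 1) k X \<longleftrightarrow> sdp_optimal M k X"
proof -
  have "mat_inner (r *\<^sub>R M + s *\<^sub>R mat 1) Y = r * mat_inner M Y + s"
    if "Y \<in> sdp_feasible k" for Y
    using that by (simp add: mat_inner_eq_inner inner_add_left inner_mat_1_left sdp_feasible_iff)
  then show ?thesis
    using assms unfolding sdp_optimal_def is_arg_max_linorder by auto
qed

lemma abs_inner_mult_le_spectral_norm:
  "\<bar>u \<bullet> (A *v v)\<bar> \<le> spectral_norm A * norm u * norm v"
proof -
  have "\<bar>u \<bullet> (A *v v)\<bar> \<le> norm u * norm (A *v v)" by (rule Cauchy_Schwarz_ineq2)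
  also have "\<dots> \<le> norm u * (spectral_norm A * norm v)"
    unfolding spectral_norm_def
    by (intro mult_left_mono onorm matrix_vector_mul_bounded_linear) auto
  finally show ?thesis by (simp add: ac_simps)
qed

theorem theorem4p3:
  fixes xbar :: "real^'n" and \<Sigma> \<Sigma>bar :: "real^'n^'n"
    and \<beta> t c \<nu> :: real and k :: nat
  assumes "\<beta> \<ge> 0"
    and "\<Sigma>bar = \<beta> *\<^sub>R outer xbar + t *\<^sub>R mat 1"
    and "l0norm xbar = k" and "k \<ge> 2" and "norm xbar = 1"
    and "\<Sigma> \<in> sym_mats"
    and "c = Min {\<bar>xbar $ i\<bar> | i. i \<in> supp xbar}"
    and "spectral_norm (proj_perp (\<Sigma> - \<Sigma>bar)) < \<nu> * \<beta>"
    and "\<nu> < min (1 / 2 * inverse (3 / 2 + (3 + 4 * sqrt 2) / c)) (c\<^sup>2 / 4)"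
  shows "sdp_exact \<Sigma> k"
proof -
  let ?C = "{\<bar>xbar $ i\<bar> | i. i \<in> supp xbar}"
  have "xbar \<noteq> 0" using assms(5) by auto
  then have "?C \<noteq> {}" by (auto simp: supp_def vec_eq_iff)
  moreover have fin: "finite ?C" by simp
  ultimately have "c \<in> ?C" unfolding assms(7) by (intro Min_in)
  then have c: "c > 0" by (auto simp: supp_def)
  have cle: "c \<le> \<bar>xbar $ i\<bar>" if "i \<in> supp xbar" for i
    unfolding assms(7) using that by (intro Min_le fin) auto

  define D where "D = proj_perp (\<Sigma> - \<Sigma>bar)"
  have D0: "0 \<le> spectral_norm D"
    unfolding spectral_norm_def by (intro onorm_pos_le matrix_vector_mul_bounded_linear)
  then have "0 < \<nu> * \<beta>" using assms(8) unfolding D_def by linarith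
  \<comment> \<open>The strict bound on a nonnegative spectral norm excludes
    \<open>\<beta> = 0\<close>, so division by \<beta> is possible.\<close>
  then have \<beta>: "\<beta> > 0" using assms(1) by (cases "\<beta> = 0") auto
  define r where "r = trace (\<Sigma> - \<Sigma>bar) / real CARD('n)"
  have diff: "\<Sigma> - \<Sigma>bar \<in> sym_mats"
    using assms(6) sym_mats_outer[of xbar] unfolding assms(2)
    by (auto simp: sym_mats_def transpose_def mat_def vec_eq_iff)
  have D: "D = \<Sigma> - \<Sigma>bar - r *\<^sub>R mat 1"
    unfolding D_def r_def by (rule proj_perp_eq[OF diff])
  define E where "E = (1 / \<beta>) *\<^sub>R D"
  have \<Sigma>: "\<Sigma> = \<beta> *\<^sub>R (outer xbar + E) + (t + r) *\<^sub>R mat 1"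
    using \<beta> by (simp add: E_def D assms(2) algebra_simps)
  have Esym: "E \<in> sym_mats"
    using diff by (auto simp: E_def D sym_mats_def transpose_def mat_def vec_eq_iff)
  define \<epsilon> where "\<epsilon> = spectral_norm D / \<beta>"
  have E: "\<bar>u \<bullet> (E *v v)\<bar> \<le> \<epsilon> * norm u * norm v" for u v
    using abs_inner_mult_le_spectral_norm[of u D v] \<beta>
    by (simp add: E_def \<epsilon>_def scaleR_matrix_vector_assoc[symmetric] abs_mult divide_right_mono)
  have "\<epsilon> < \<nu>" using assms(8) \<beta> by (simp add: \<epsilon>_def D_def field_simps)
  \<comment> \<open>Since 8 \<le> 3 + 4 sqrt 2, the inverse is at most \<open>c / 8\<close>; the
    factor 1/2 gives the threshold \<open>16 * \<epsilon> \<le> c\<close> of the perturbation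
    lemma.\<close>
  moreover have "\<nu> < c / 16"
  proof -
    have "5/4 \<le> sqrt 2" by (rule real_le_rsqrt) (simp add: power2_eq_square)
    then have "8 / c \<le> (3 + 4 * sqrt 2) / c" using c by (intro divide_right_mono) auto
    then have "inverse (3 / 2 + (3 + 4 * sqrt 2) / c) \<le> inverse (8 / c)"
      using c by (intro le_imp_inverse_le) auto
    then show ?thesis using assms(9) by simp
  qed
  ultimately have "16 * \<epsilon> \<le> c" by simp
  moreover have "0 \<le> \<epsilon>" using D0 \<beta> by (simp add: \<epsilon>_def)
  ultimately have "\<exists>x. norm x = 1 \<and> X = outer x" if "sdp_optimal \<Sigma> k X" for X
    using sdp_optimal_eq_outer_of_rank_one_perturbation[OF assms(5,3) c cle Esym E, of X]
      that unfolding \<Sigma> sdp_optimal_scaleR_add_mat_1[OF \<beta>] by metis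
  then show ?thesis
    unfolding sdp_exact_def using rank_outer by (metis norm_zero zero_neq_one)
qed

end
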